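(* Let $p$ be a prime and let $1\le\alpha_1\le\alpha_2$ be integers. Then $$\operatorname{cdeg}(\mathbb{Z}_{p^{\alpha_1}}\times\mathbb{Z}_{p^{\alpha_2}})=\frac{(\alpha_2-\alpha_1+1)p^{\alpha_1+2}-2(\alpha_2-\alpha_1)p^{\alpha_1+1}+(\alpha_2-\alpha_1-1)p^{\alpha_1}-2p+2}{(\alpha_2-\alpha_1+1)p^{\alpha_1+2}-(\alpha_2-\alpha_1-1)p^{\alpha_1+1}-(\alpha_1+\alpha_2+3)p+(\alpha_1+\alpha_2+1)}.$$
   Context: For a finite group $G$, let $L(G)$ be the set of all subgroups of $G$ and $C(G)$ the set of all cyclic subgroups of $G$. The cyclicity degree of $G$ is $\operatorname{cdeg}(G)=|C(G)|/|L(G)|$. $\mathbb{Z}_n$ denotes the cyclic group of order $n$. *)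

theory Defs
  imports Complex_Main "HOL-Computational_Algebra.Primes" "HOL-Algebra.Elementary_Groups"
begin

definition subgroups :: "('a, 'b) monoid_scheme \<Rightarrow> 'a set set" where
  "subgroups G = {H. subgroup H G}"

definition cyclic_subgroups :: "('a, 'b) monoid_scheme \<Rightarrow> 'a set set" where
  "cyclic_subgroups G = {H. subgroup H G \<and> cyclic_group (G\<lparr>carrier := H\<rparr>)}"

(* Intended for finite groups only: card makes the value meaningless if G has
   infinitely many subgroups. *)
definition cdeg :: "('a, 'b) monoid_scheme \<Rightarrow> real" where
  "cdeg G = real (card (cyclic_subgroups G)) / real (card (subgroups G))"

end

theory Submission
  imports Defs
begin

text \<open>
  Subgroups of \<open>\<int>\<^sub>m \<times> \<int>\<^sub>n\<close> correspond to sublattices of \<open>\<int> \<times> \<int>\<close> containing \<open>(m, 0)\<close> and \<open>(0, n)\<close>.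
  Counting Hermite normal forms, there are \<open>\<Sum>d dvd m. \<Sum>e dvd n. gcd e (m div d)\<close> of them, which for
  \<open>m = p ^ a\<close>, \<open>n = p ^ b\<close> becomes \<open>N a b = (\<Sum>i\<le>a. \<Sum>j\<le>b. p ^ min i j)\<close>. A subgroup of the product is
  non-cyclic iff it contains the whole \<open>p\<close>-torsion, that is, iff its lattice contains
  \<open>(p ^ (a - 1), 0)\<close> and \<open>(0, p ^ (b - 1))\<close>; so there are \<open>N (a - 1) (b - 1)\<close> non-cyclic ones.
  Both counts are evaluated by the recursion \<open>N (a + 1) (b + 1) = a + b + 3 + p * N a b\<close>.
\<close>

section \<open>Lattices between \<open>m\<close> Z x \<open>n\<close> Z and Z x Z\<close>

text \<open>A nonempty set closed under differences is a subgroup of Z x Z, so these are exactly the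
  subgroups containing \<open>m\<close> Z x \<open>n\<close> Z.\<close>

definition lattices :: "nat \<Rightarrow> nat \<Rightarrow> (int \<times> int) set set" where
  "lattices m n = {K. (int m, 0) \<in> K \<and> (0, int n) \<in> K \<and>
     (\<forall>x y u w. (x, y) \<in> K \<longrightarrow> (u, w) \<in> K \<longrightarrow> (x - u, y - w) \<in> K)}"

lemma lattice_diff:
  "K \<in> lattices m n \<Longrightarrow> (x, y) \<in> K \<Longrightarrow> (u, w) \<in> K \<Longrightarrow> (x - u, y - w) \<in> K"
  by (auto simp: lattices_def)

lemma lattice_zero: "K \<in> lattices m n \<Longrightarrow> (0, 0) \<in> K"
  using lattice_diff[of K m n "int m" 0 "int m" 0] by (auto simp: lattices_def)

lemma lattice_add:
  assumes "K \<in> lattices m n" "(x, y) \<in> K" "(u, w) \<in> K"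
  shows "(x + u, y + w) \<in> K"
  using lattice_diff[OF assms(1,2) lattice_diff[OF assms(1) lattice_zero[OF assms(1)] assms(3)]]
  by simp

lemma lattice_scale:
  fixes k :: int
  assumes "K \<in> lattices m n" "(x, y) \<in> K"
  shows "(k * x, k * y) \<in> K"
proof (induction k rule: int_induct[where k = 0])
  case base
  show ?case using lattice_zero[OF assms(1)] by simp
next
  case (step1 i)
  then show ?case using lattice_add[OF assms(1) step1(2) assms(2)] by (simp add: algebra_simps)
next
  case (step2 i)
  then show ?case using lattice_diff[OF assms(1) step2(2) assms(2)] by (simp add: algebra_simps)
qed

lemma lattice_lincomb:
  fixes k l :: int
  assumes "K \<in> lattices m n" "(x, y) \<in> K" "(u, w) \<in> K"
  shows "(k * x + l * u, k * y + l * w) \<in> K"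
  using assms by (intro lattice_add[OF assms(1)] lattice_scale) auto

text \<open>\<open>K\<close> is a union of cosets of \<open>m\<close> Z x \<open>n\<close> Z, so it
  is determined by its reduced residue pairs.\<close>

lemma lattice_cong_mem:
  assumes "K \<in> lattices m n" "(x, y) \<in> K" "int m dvd u - x" "int n dvd w - y"
  shows "(u, w) \<in> K"
proof -
  obtain k l where kl: "u - x = int m * k" "w - y = int n * l"
    using assms(3,4) by (auto elim!: dvdE)
  have "(k * int m + l * 0, k * 0 + l * int n) \<in> K"
    using assms(1) by (intro lattice_lincomb[OF assms(1)]) (auto simp: lattices_def)
  from lattice_add[OF assms(1,2) this] kl show ?thesis
    by (simp add: algebra_simps)
qed

text \<open>Division by the least positive element \<open>d\<close> of \<open>A\<close> leaves a
  remainder in \<open>A\<close> that is smaller than \<open>d\<close>, hence zero. It serves below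
  for the first projection of a lattice and for its fibre over 0.\<close>

lemma int_diff_closed_principal:
  fixes A :: "int set"
  assumes "int m \<in> A" "m > 0" "\<And>x y. x \<in> A \<Longrightarrow> y \<in> A \<Longrightarrow> x - y \<in> A"
  obtains d where "d > 0" "d dvd m" "A = {x. int d dvd x}"
proof -
  define d where "d = (LEAST d. d > 0 \<and> int d \<in> A)"
  have d: "d > 0 \<and> int d \<in> A"
    unfolding d_def by (rule LeastI[of _ m]) (use assms in auto)
  have least: "d \<le> k" if "k > 0" "int k \<in> A" for k
    unfolding d_def by (rule Least_le) (use that in auto)
  have zero: "0 \<in> A" using assms(3)[of "int m" "int m"] assms(1) by simp
  have neg: "- x \<in> A" if "x \<in> A" for x using assms(3)[OF zero that] by simp
  have add: "x + y \<in> A" if "x \<in> A" "y \<in> A" for x y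
    using assms(3)[OF that(1) neg[OF that(2)]] by simp
  have mult: "k * int d \<in> A" for k
  proof (induction k rule: int_induct[where k = 0])
    case base show ?case using zero by simp
  next
    case (step1 i) then show ?case using add[OF step1(2), of "int d"] d by (simp add: algebra_simps)
  next
    case (step2 i) then show ?case using assms(3)[OF step2(2), of "int d"] d by (simp add: algebra_simps)
  qed
  have A: "A = {x. int d dvd x}"
  proof (intro equalityI subsetI CollectI)
    fix x assume x: "x \<in> A"
    have "x mod int d = x - (x div int d) * int d" by (simp add: minus_div_mult_eq_mod)
    then have r: "x mod int d \<in> A" using assms(3)[OF x mult] by simp
    show "int d dvd x"
    proof (rule ccontr)
      assume "\<not> int d dvd x"
      then have "x mod int d > 0"
        using d by (metis dvd_eq_mod_eq_0 of_nat_0_less_iff order_neq_le_trans pos_mod_sign)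
      with r least[of "nat (x mod int d)"] have "int d \<le> x mod int d" by auto
      moreover have "x mod int d < int d" using d by simp
      ultimately show False by simp
    qed
  next
    fix x assume "x \<in> {x. int d dvd x}"
    then show "x \<in> A" using mult by (auto elim!: dvdE simp: mult.commute)
  qed
  from that[of d] A d assms(1) show thesis by auto
qed

section \<open>Hermite normal forms\<close>

text \<open>
  Hermite normal form: \<open>hermite (d, e, t)\<close> is the lattice spanned by \<open>(d, t)\<close> and \<open>(0, e)\<close>. It contains
  \<open>(m, 0)\<close> exactly when \<open>d\<close> divides \<open>m\<close> and \<open>e\<close> divides \<open>(m div d) * t\<close>.
\<close>

definition hermite :: "nat \<times> nat \<times> nat \<Rightarrow> (int \<times> int) set" where
  "hermite = (\<lambda>(d, e, t). {(x, y). int d dvd x \<and> int e dvd y - x div int d * int t})"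

definition hermite_index :: "nat \<Rightarrow> nat \<Rightarrow> (nat \<times> nat \<times> nat) set" where
  "hermite_index m n =
     (SIGMA d:{d. d dvd m}. SIGMA e:{e. e dvd n}. {t. t < e \<and> e dvd (m div d) * t})"

lemma mem_hermite:
  "(x, y) \<in> hermite (d, e, t) \<longleftrightarrow> int d dvd x \<and> int e dvd y - x div int d * int t"
  by (simp add: hermite_def)

lemma hermite_basis:
  assumes "d > 0"
  shows "(int d, int t) \<in> hermite (d, e, t)" "(0, int e) \<in> hermite (d, e, t)"
  using assms by (auto simp: mem_hermite)

lemma hermite_in_lattices:
  assumes "m > 0" "(d, e, t) \<in> hermite_index m n"
  shows "hermite (d, e, t) \<in> lattices m n"
proof -
  have de: "d dvd m" "e dvd n" "e dvd (m div d) * t" "d > 0"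
    using assms by (auto simp: hermite_index_def intro!: Nat.gr0I)
  have "int e dvd int ((m div d) * t)" using de(3) by (simp only: int_dvd_int_iff)
  then have 1: "(int m, 0) \<in> hermite (d, e, t)"
    using de by (simp add: mem_hermite zdiv_int)
  have 2: "(0, int n) \<in> hermite (d, e, t)" using de by (simp add: mem_hermite)
  have "(x - u, y - w) \<in> hermite (d, e, t)"
    if "(x, y) \<in> hermite (d, e, t)" "(u, w) \<in> hermite (d, e, t)" for x y u w
  proof -
    have "int d dvd x" "int d dvd u" "int e dvd y - x div int d * int t"
      "int e dvd w - u div int d * int t"
      using that by (auto simp: mem_hermite)
    moreover from calculation have "(x - u) div int d = x div int d - u div int d"
      by (simp add: div_diff)
    moreover have "int e dvd (y - x div int d * int t) - (w - u div int d * int t)"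
      by (rule dvd_diff) fact+
    ultimately show ?thesis by (simp add: mem_hermite algebra_simps)
  qed
  with 1 2 show ?thesis by (auto simp: lattices_def)
qed

text \<open>The basis vectors of each lattice lie in the other, so \<open>d\<close> and
  \<open>d'\<close> divide each other, likewise \<open>e\<close> and \<open>e'\<close>, and
  \<open>t\<close>, \<open>t'\<close> agree modulo \<open>e\<close>. The bound \<open>t < e\<close>
  then forces \<open>t = t'\<close>.\<close>

lemma inj_on_hermite:
  assumes "m > 0"
  shows "inj_on hermite (hermite_index m n)"
proof (rule inj_onI)
  fix i i' assume i: "i \<in> hermite_index m n" "i' \<in> hermite_index m n" "hermite i = hermite i'"
  obtain d e t d' e' t' where det: "i = (d, e, t)" "i' = (d', e', t')"
    by (metis prod_cases3)
  note idx = i(1,2)[unfolded det] and eq = i(3)[unfolded det]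
  have pos: "d > 0" "d' > 0" "t < e" "t' < e'"
    using idx assms by (auto simp: hermite_index_def intro!: Nat.gr0I)
  note b = hermite_basis[OF pos(1), where t = t and e = e] and b' = hermite_basis[OF pos(2), where t = t' and e = e']
  have d: "d = d'"
    using b(1)[unfolded eq mem_hermite] b'(1)[folded eq, unfolded mem_hermite] by (simp add: dvd_antisym)
  have e: "e = e'"
    using b(2)[unfolded eq mem_hermite] b'(2)[folded eq, unfolded mem_hermite]
    by (intro dvd_antisym) simp_all
  have "int e dvd int t' - int t"
    using b'(1)[folded eq, unfolded mem_hermite] d pos by simp
  then have "int t' mod int e = int t mod int e" by (simp add: mod_eq_dvd_iff)
  then have "t = t'" using pos e by simp
  with d e show "i = i'" by (simp add: det)
qed

text \<open>Here \<open>d\<close> generates the projection of \<open>K\<close> to the first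
  coordinate, \<open>e\<close> generates the fibre over 0, and \<open>t\<close> is the second
  coordinate, reduced modulo \<open>e\<close>, of a point over \<open>d\<close>.\<close>

lemma lattice_eq_hermite:
  assumes "m > 0" "n > 0" and K: "K \<in> lattices m n"
  obtains d e t where "(d, e, t) \<in> hermite_index m n" "K = hermite (d, e, t)"
proof -
  have mn: "(int m, 0) \<in> K" "(0, int n) \<in> K" using K by (auto simp: lattices_def)
  obtain d where d: "d > 0" "d dvd m" "fst ` K = {x. int d dvd x}"
  proof (rule int_diff_closed_principal[of m "fst ` K"])
    show "int m \<in> fst ` K" using mn by force
    show "x - y \<in> fst ` K" if "x \<in> fst ` K" "y \<in> fst ` K" for x y
      using that lattice_diff[OF K] by force
  qed (use assms in auto)
  obtain e where e: "e > 0" "e dvd n" "{y. (0, y) \<in> K} = {x. int e dvd x}"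
  proof (rule int_diff_closed_principal[of n "{y. (0, y) \<in> K}"])
    show "x - y \<in> {y. (0, y) \<in> K}" if "x \<in> {y. (0, y) \<in> K}" "y \<in> {y. (0, y) \<in> K}" for x y
      using that lattice_diff[OF K, of 0 x 0 y] by simp
  qed (use assms mn in auto)
  have e_iff: "(0, y) \<in> K \<longleftrightarrow> int e dvd y" for y using e(3) by auto
  have "int d \<in> fst ` K" using d by simp
  then obtain s where s: "(int d, s) \<in> K" by force
  define t where "t = nat (s mod int e)"
  have te: "t < e" "int t = s mod int e" using e by (auto simp: t_def nat_less_iff)
  have "(0, s div int e * int e) \<in> K" by (simp add: e_iff)
  from lattice_diff[OF K s this] have t: "(int d, int t) \<in> K"
    by (simp add: te minus_div_mult_eq_mod)
  \<comment> \<open>Subtracting \<open>x div d\<close> times \<open>(d, t)\<close> moves the point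
    into the fibre over 0.\<close>
  have mem: "(x, y) \<in> K \<longleftrightarrow> int e dvd y - x div int d * int t" if "int d dvd x" for x y
  proof -
    have x: "x = x div int d * int d" using that by simp
    have kt: "(x, x div int d * int t) \<in> K"
      using lattice_scale[OF K t, of "x div int d"] x by simp
    have "(x, y) \<in> K \<longleftrightarrow> (0, y - x div int d * int t) \<in> K"
      using lattice_diff[OF K _ kt, of x y] lattice_add[OF K kt, of 0 "y - x div int d * int t"]
      by auto
    then show ?thesis by (simp add: e_iff)
  qed
  have fst: "int d dvd x" if "(x, y) \<in> K" for x y
    using that d(3) by force
  have "K = hermite (d, e, t)"
    using mem fst unfolding set_eq_iff split_paired_All mem_hermite by blast
  moreover have "(d, e, t) \<in> hermite_index m n"
  proof -
    have "int e dvd int (m div d) * int t"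
      using mem[of "int m" 0] mn d by (simp add: zdiv_int)
    then have "e dvd (m div d) * t" by (simp flip: of_nat_mult)
    with te d e show ?thesis by (auto simp: hermite_index_def)
  qed
  ultimately show thesis using that by blast
qed

lemma bij_betw_hermite:
  assumes "m > 0" "n > 0"
  shows "bij_betw hermite (hermite_index m n) (lattices m n)"
  unfolding bij_betw_def
proof (intro conjI equalityI subsetI)
  show "inj_on hermite (hermite_index m n)" by (rule inj_on_hermite[OF assms(1)])
  show "K \<in> lattices m n" if "K \<in> hermite ` hermite_index m n" for K
    using that hermite_in_lattices[OF assms(1)] by auto
  show "K \<in> hermite ` hermite_index m n" if "K \<in> lattices m n" for K
    using lattice_eq_hermite[OF assms that] by blast
qed

section \<open>Counting lattices\<close>

text \<open>After cancelling \<open>g = gcd e k\<close>, the condition on \<open>t\<close> is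
  divisibility by \<open>e' = e / g\<close>, and there are \<open>g\<close> multiples of
  \<open>e'\<close> below \<open>e' * g\<close>.\<close>

lemma card_linear_congruence:
  fixes e k :: nat
  assumes "e > 0"
  shows "card {t. t < e \<and> e dvd k * t} = gcd e k"
proof -
  define g where "g = gcd e k"
  have g: "g > 0" using assms by (simp add: g_def)
  obtain e' k' where ek: "e = e' * g" "k = k' * g" "coprime e' k'"
    unfolding g_def using gcd_coprime_exists[of e k] assms by auto
  have e': "e' > 0" using ek assms by (intro Nat.gr0I) auto
  have "{t. t < e \<and> e dvd k * t} = (\<lambda>s. e' * s) ` {..<g}"
  proof (intro equalityI subsetI)
    fix t assume t: "t \<in> {t. t < e \<and> e dvd k * t}"
    then have "e' * g dvd (k' * t) * g" by (simp add: ek ac_simps)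
    then have "e' dvd k' * t" using g by simp
    then have "e' dvd t" using ek(3) by (simp add: coprime_dvd_mult_right_iff)
    then obtain s where "t = e' * s" ..
    with t e' ek(1) show "t \<in> (\<lambda>s. e' * s) ` {..<g}" by auto
  next
    fix t assume "t \<in> (\<lambda>s. e' * s) ` {..<g}"
    then show "t \<in> {t. t < e \<and> e dvd k * t}" using e' by (auto simp: ek)
  qed
  moreover have "inj_on (\<lambda>s. e' * s) {..<g}" using e' by (auto intro: inj_onI)
  ultimately show ?thesis by (simp add: card_image g_def)
qed

lemma finite_lattices:
  assumes "m > 0" "n > 0"
  shows "finite (lattices m n)"
proof -
  have "finite (hermite_index m n)"
    using assms by (auto simp: hermite_index_def intro!: finite_SigmaI)
  then show ?thesis using bij_betw_finite[OF bij_betw_hermite[OF assms]] by simp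
qed

lemma card_lattices:
  assumes "m > 0" "n > 0"
  shows "card (lattices m n) = (\<Sum>d | d dvd m. \<Sum>e | e dvd n. gcd e (m div d))"
proof -
  have "card (lattices m n) = card (hermite_index m n)"
    using bij_betw_same_card[OF bij_betw_hermite[OF assms]] by simp
  also have "\<dots> = (\<Sum>d | d dvd m. \<Sum>e | e dvd n. card {t. t < e \<and> e dvd (m div d) * t})"
    unfolding hermite_index_def
    using assms by (subst card_SigmaI; simp add: card_SigmaI)
  also have "\<dots> = (\<Sum>d | d dvd m. \<Sum>e | e dvd n. gcd e (m div d))"
    using assms by (intro sum.cong refl card_linear_congruence) (auto intro!: Nat.gr0I)
  finally show ?thesis .
qed

lemma card_lattices_prime_power:
  assumes "prime p"
  shows "card (lattices (p ^ a) (p ^ b)) = (\<Sum>i\<le>a. \<Sum>j\<le>b. p ^ min i j)"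
proof -
  have p: "p > 1" using assms prime_gt_1_nat by blast
  have bij: "bij_betw (\<lambda>j. p ^ j) {..b} {d. d dvd p ^ b}" for b
    unfolding bij_betw_def using p assms by (auto simp: inj_on_def divides_primepow_nat)
  \<comment> \<open>The divisors of \<open>p ^ a\<close> are listed in reverse, so that the cofactor
    \<open>p ^ a div d\<close> becomes \<open>p ^ i\<close>.\<close>
  have bij': "bij_betw (\<lambda>i. p ^ (a - i)) {..a} {d. d dvd p ^ a}"
  proof -
    have "bij_betw (\<lambda>i. a - i) {..a} {..a}"
      by (rule bij_betw_byWitness[where f' = "\<lambda>i. a - i"]) auto
    from bij_betw_trans[OF this bij] show ?thesis by (simp add: comp_def)
  qed
  have gcd: "gcd (p ^ j) (p ^ i) = p ^ min i j" for i j
    by (cases "i \<le> j") (simp_all add: min_def le_imp_power_dvd gcd_proj1_if_dvd_nat gcd_proj2_if_dvd_nat)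
  have "card (lattices (p ^ a) (p ^ b)) = (\<Sum>d | d dvd p ^ a. \<Sum>e | e dvd p ^ b. gcd e (p ^ a div d))"
    using p by (intro card_lattices) auto
  also have "\<dots> = (\<Sum>i\<le>a. \<Sum>j\<le>b. gcd (p ^ j) (p ^ a div p ^ (a - i)))"
    by (simp add: sum.reindex_bij_betw[OF bij', symmetric] sum.reindex_bij_betw[OF bij, symmetric])
  also have "\<dots> = (\<Sum>i\<le>a. \<Sum>j\<le>b. p ^ min i j)"
  proof (intro sum.cong refl)
    fix i j assume "i \<in> {..a}"
    then have "p ^ a div p ^ (a - i) = p ^ i" using p by (simp flip: power_diff)
    then show "gcd (p ^ j) (p ^ a div p ^ (a - i)) = p ^ min i j" by (simp add: gcd)
  qed
  finally show ?thesis .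
qed

section \<open>Evaluation of the double sum\<close>

text \<open>The terms with \<open>i = 0\<close> or \<open>j = 0\<close> are \<open>a + b + 3\<close>
  ones; shifting both indices down by one takes a factor \<open>x\<close> out of every other
  term.\<close>

lemma sum_power_min_Suc:
  fixes x :: real
  shows "(\<Sum>i\<le>Suc a. \<Sum>j\<le>Suc b. x ^ min i j) = real a + real b + 3 + x * (\<Sum>i\<le>a. \<Sum>j\<le>b. x ^ min i j)"
  by (simp add: sum.atMost_Suc_shift sum.distrib sum_distrib_left del: sum.atMost_Suc)

text \<open>The recursion lowers both bounds together, so the induction keeps their difference
  \<open>c\<close> fixed. The factor \<open>(x - 1)\<^sup>2\<close> avoids any division.\<close>

lemma sum_power_min_closed_form:
  fixes x :: real
  shows "(x - 1)\<^sup>2 * (\<Sum>i\<le>a. \<Sum>j\<le>a + c. x ^ min i j) =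
    (real c + 1) * x ^ (a + 2) - (real c - 1) * x ^ (a + 1)
      - (2 * real a + real c + 3) * x + (2 * real a + real c + 1)"
proof (induction a)
  case 0
  then show ?case by (simp add: algebra_simps power2_eq_square)
next
  case (Suc a)
  have "(x - 1)\<^sup>2 * (\<Sum>i\<le>Suc a. \<Sum>j\<le>Suc a + c. x ^ min i j) =
    (x - 1)\<^sup>2 * (2 * real a + real c + 3) + x * ((x - 1)\<^sup>2 * (\<Sum>i\<le>a. \<Sum>j\<le>a + c. x ^ min i j))"
    unfolding add_Suc sum_power_min_Suc by (simp add: algebra_simps)
  then show ?case unfolding Suc by (simp add: algebra_simps power2_eq_square)
qed

section \<open>Cyclic quotients and \<open>p\<close>-torsion\<close>

text \<open>The quotient of \<open>K\<close> by \<open>m\<int> \<times> n\<int>\<close> is cyclic.\<close>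

definition generated_mod :: "nat \<Rightarrow> nat \<Rightarrow> (int \<times> int) set \<Rightarrow> bool" where
  "generated_mod m n K \<longleftrightarrow> (\<exists>(x, y) \<in> K. \<forall>(u, w) \<in> K. \<exists>k. int m dvd u - k * x \<and> int n dvd w - k * y)"

text \<open>Suppose \<open>k\<close> and \<open>l\<close> times a generator \<open>(x, y)\<close>
  give the two torsion elements. As \<open>p ^ Suc a\<close> divides \<open>l * x\<close> but not
  \<open>k * x\<close>, the \<open>p\<close>-adic valuation of \<open>k\<close> is below that of
  \<open>l\<close>; the second coordinate gives the opposite inequality.\<close>

lemma generated_mod_imp_not_torsion:
  assumes "prime p" and "generated_mod (p ^ Suc a) (p ^ Suc b) K"
  shows "\<not> ((int (p ^ a), 0) \<in> K \<and> (0, int (p ^ b)) \<in> K)"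
proof
  assume tors: "(int (p ^ a), 0) \<in> K \<and> (0, int (p ^ b)) \<in> K"
  let ?p = "int p"
  have p: "prime ?p" using assms by simp
  obtain x y where gen: "\<And>u w. (u, w) \<in> K \<Longrightarrow> \<exists>k. int (p ^ Suc a) dvd u - k * x \<and> int (p ^ Suc b) dvd w - k * y"
    using assms(2) by (fastforce simp: generated_mod_def)
  obtain k where k: "?p ^ Suc a dvd ?p ^ a - k * x" "?p ^ Suc b dvd k * y"
    using gen[of "int (p ^ a)" 0] tors by auto
  obtain l where l: "?p ^ Suc a dvd l * x" "?p ^ Suc b dvd ?p ^ b - l * y"
    using gen[of 0 "int (p ^ b)"] tors by auto
  have nd: "\<not> ?p ^ Suc c dvd z" if "?p ^ Suc c dvd ?p ^ c - z" for c z
  proof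
    assume "?p ^ Suc c dvd z"
    with that have "?p ^ Suc c dvd ?p ^ c - z + z" by (rule dvd_add)
    then have "?p ^ Suc c dvd ?p ^ c" by simp
    then have "\<bar>?p ^ Suc c\<bar> \<le> \<bar>?p ^ c\<bar>" using p by (intro dvd_imp_le_int) auto
    moreover have "?p ^ c < ?p ^ Suc c" using prime_gt_1_int[OF p] by (intro power_strict_increasing) auto
    ultimately show False by simp
  qed
  have kx: "\<not> ?p ^ Suc a dvd k * x" and ly: "\<not> ?p ^ Suc b dvd l * y" using nd k l by auto
  \<comment> \<open>A zero factor would make \<open>k * x\<close> or \<open>l * y\<close> divisible
    by every power of \<open>p\<close>. Comparing valuations requires nonzero factors.\<close>
  have nz: "k \<noteq> 0" "x \<noteq> 0" "l \<noteq> 0" "y \<noteq> 0" using kx ly by auto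
  have dvd_iff: "?p ^ i dvd r * z \<longleftrightarrow> i \<le> multiplicity ?p r + multiplicity ?p z"
    if "r \<noteq> 0" "z \<noteq> 0" for i r z
    using that p by (subst power_dvd_iff_le_multiplicity)
      (simp_all add: prime_elem_multiplicity_mult_distrib prime_nat_iff)
  have "multiplicity ?p k < multiplicity ?p l"
    using kx l(1) unfolding dvd_iff[OF nz(1,2)] dvd_iff[OF nz(3,2)] by linarith
  moreover have "multiplicity ?p l < multiplicity ?p k"
    using ly k(2) unfolding dvd_iff[OF nz(3,4)] dvd_iff[OF nz(1,4)] by linarith
  ultimately show False by simp
qed

text \<open>The Hermite basis has relations with entries \<mu>, \<nu>, \<sigma>. If \<open>p\<close>
  divides all three, the relations can be divided by \<open>p\<close>, which puts both torsion
  elements into \<open>K\<close>; in every other case one basis vector generates the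
  quotient.\<close>

lemma generated_mod_if_not_torsion:
  assumes p: "prime p" and K: "K \<in> lattices (p ^ Suc a) (p ^ Suc b)"
    and tors: "\<not> ((int (p ^ a), 0) \<in> K \<and> (0, int (p ^ b)) \<in> K)"
  shows "generated_mod (p ^ Suc a) (p ^ Suc b) K"
proof -
  let ?m = "p ^ Suc a" and ?n = "p ^ Suc b"
  have p0: "p > 0" using p prime_gt_0_nat by blast
  obtain d e t where idx: "(d, e, t) \<in> hermite_index ?m ?n" and Kh: "K = hermite (d, e, t)"
    using lattice_eq_hermite[OF _ _ K] p0 by auto
  have "d dvd ?m" "e dvd ?n" and dvd: "e dvd (?m div d) * t"
    using idx by (auto simp: hermite_index_def)
  then obtain \<mu> \<nu> where \<mu>: "?m = d * \<mu>" and \<nu>: "?n = e * \<nu>" by (metis dvdE)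
  have d: "d > 0" and e: "e > 0" using \<mu> \<nu> p0 by (auto intro!: Nat.gr0I)
  have "?m div d = \<mu>" using \<mu> d by (metis nonzero_mult_div_cancel_left less_not_refl)
  then obtain \<sigma> where \<sigma>: "\<mu> * t = e * \<sigma>" using dvd by (metis dvdE)
  have iM: "int ?m = int d * int \<mu>" "int ?n = int e * int \<nu>" "int \<mu> * int t = int e * int \<sigma>"
    using \<mu> \<nu> \<sigma> by (metis of_nat_mult)+
  have par: "\<exists>k l. u = int d * k \<and> w = int t * k + int e * l" if "(u, w) \<in> K" for u w
  proof -
    from that obtain k where k: "u = int d * k" by (auto simp: Kh mem_hermite elim!: dvdE)
    with that d obtain l where "w - k * int t = int e * l" by (auto simp: Kh mem_hermite elim!: dvdE)
    with k show ?thesis by (intro exI[of _ k] exI[of _ l]) (auto simp: algebra_simps)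
  qed
  have genI: "generated_mod ?m ?n K"
    if xy: "(x, y) \<in> K"
      and c: "\<And>k l. \<exists>c. int ?m dvd int d * k - c * x \<and> int ?n dvd int t * k + int e * l - c * y" for x y
    unfolding generated_mod_def
  proof (intro bexI[OF _ xy], clarify)
    fix u w assume "(u, w) \<in> K"
    from par[OF this] obtain k l where "u = int d * k" "w = int t * k + int e * l" by blast
    with c[of k l] show "\<exists>k. int ?m dvd u - k * x \<and> int ?n dvd w - k * y" by simp
  qed
  note basis = hermite_basis[OF d, where t = t and e = e, folded Kh]
  \<comment> \<open>Since \<mu> and \<nu> divide powers of \<open>p\<close>, being prime to
    \<open>p\<close> means being 1 for them; \<sigma> has no such restriction.\<close>
  have unit: "q = 1" if "\<not> p dvd q" "q dvd p ^ c" for q c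
    using that p by (metis divides_primepow_nat dvd_power power_0 neq0_conv)
  \<comment> \<open>Modulo \<open>(m, 0)\<close> and \<open>(0, n)\<close> the basis \<open>(d, t)\<close>, \<open>(0, e)\<close> satisfies the relations \<open>(\<mu>, -\<sigma>)\<close> and
    \<open>(0, \<nu>)\<close>; the quotient is cyclic as soon as one of these entries is prime to \<open>p\<close>.\<close>
  consider "\<mu> = 1" | "\<nu> = 1" | "\<not> p dvd \<sigma>" | "p dvd \<mu>" "p dvd \<nu>" "p dvd \<sigma>"
    using unit \<mu> \<nu> by (metis dvd_triv_right)
  then show ?thesis
  proof cases
    case 1
    \<comment> \<open>With \<mu> = 1, \<open>(d, t)\<close> is congruent to \<sigma> times
      \<open>(0, e)\<close>, so \<open>(0, e)\<close> generates.\<close>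
    show ?thesis
    proof (rule genI[OF basis(2)])
      fix k l
      have "int t * k + int e * l - (k * int \<sigma> + l) * int e = k * (int \<mu> * int t - int e * int \<sigma>)"
        using 1 by (simp add: algebra_simps)
      then have "int t * k + int e * l - (k * int \<sigma> + l) * int e = 0" using iM(3) by simp
      moreover have "int ?m dvd int d * k" unfolding iM using 1 by simp
      ultimately show "\<exists>c. int ?m dvd int d * k - c * 0 \<and> int ?n dvd int t * k + int e * l - c * int e"
        by (intro exI[of _ "k * int \<sigma> + l"]) simp
    qed
  next
    case 2
    \<comment> \<open>With \<nu> = 1, \<open>e\<close> equals \<open>?n\<close>, so
      \<open>(0, e)\<close> vanishes and \<open>(d, t)\<close> generates.\<close>
    show ?thesis
    proof (rule genI[OF basis(1)])
      fix k l
      show "\<exists>c. int ?m dvd int d * k - c * int d \<and> int ?n dvd int t * k + int e * l - c * int t"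
        unfolding iM(2) using 2 by (intro exI[of _ k]) simp
    qed
  next
    case 3
    have "coprime \<sigma> ?n" using 3 p by (metis coprime_commute coprime_power_right_iff prime_imp_coprime)
    then have "coprime (int \<sigma>) (int ?n)" by simp
    then obtain s r where "s * int \<sigma> + r * int ?n = 1" using bezout_int by (metis coprime_iff_gcd_eq_1)
    then have "1 - int \<sigma> * s = int ?n * r" by (simp add: algebra_simps)
    then have s: "int ?n dvd 1 - int \<sigma> * s" by simp
    \<comment> \<open>Since \<mu> times \<open>(d, t)\<close> is congruent to \<sigma> times
      \<open>(0, e)\<close> and \<open>s\<close> inverts \<sigma> modulo \<open>?n\<close>, the
      multiple of \<open>(d, t)\<close> by \<open>s\<close> \<mu> is congruent to
      \<open>(0, e)\<close>.\<close>
    show ?thesis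
    proof (rule genI[OF basis(1)])
      fix k l
      have "int t * k + int e * l - (k + l * s * int \<mu>) * int t = int e * l - l * s * (int \<mu> * int t)"
        by (simp add: algebra_simps)
      also have "\<dots> = int e * l * (1 - int \<sigma> * s)"
        unfolding iM by (simp add: algebra_simps)
      finally have "int ?n dvd int t * k + int e * l - (k + l * s * int \<mu>) * int t"
        using s by simp
      moreover have "int d * k - (k + l * s * int \<mu>) * int d = int ?m * (- (l * s))"
        unfolding iM by (simp add: algebra_simps)
      then have "int ?m dvd int d * k - (k + l * s * int \<mu>) * int d" by (metis dvd_triv_left)
      ultimately show "\<exists>c. int ?m dvd int d * k - c * int d \<and> int ?n dvd int t * k + int e * l - c * int t"
        by blast
    qed
  next
    case 4
    \<comment> \<open>The divided relations read \<open>(p ^ a, 0)\<close> = \<mu>'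
      \<open>(d, t)\<close> - \<sigma>' \<open>(0, e)\<close> and \<open>(0, p ^ b)\<close> = \<nu>'
      \<open>(0, e)\<close>.\<close>
    then obtain \<mu>' \<nu>' \<sigma>' where q: "\<mu> = p * \<mu>'" "\<nu> = p * \<nu>'" "\<sigma> = p * \<sigma>'" by (elim dvdE)
    have "p * p ^ a = p * (d * \<mu>')" "p * p ^ b = p * (e * \<nu>')" "p * (\<mu>' * t) = p * (e * \<sigma>')"
      using \<mu> \<nu> \<sigma> q by (simp_all add: ac_simps)
    then have "p ^ a = d * \<mu>'" "p ^ b = e * \<nu>'" "\<mu>' * t = e * \<sigma>'" using p0 by simp_all
    moreover from this(3) have "int \<mu>' * int t = int e * int \<sigma>'" by (metis of_nat_mult)
    ultimately have "(int (p ^ a), 0) \<in> K \<and> (0, int (p ^ b)) \<in> K"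
      using d by (simp add: Kh mem_hermite del: of_nat_power)
    with tors show ?thesis by simp
  qed
qed

text \<open>By the torsion criterion, the lattices with non-cyclic quotient are exactly the members
  of \<open>lattices (p ^ a) (p ^ b)\<close>. The form as a sum avoids truncated
  subtraction.\<close>

lemma card_generated_lattices:
  assumes "prime p"
  shows "card {K \<in> lattices (p ^ Suc a) (p ^ Suc b). generated_mod (p ^ Suc a) (p ^ Suc b) K}
    + card (lattices (p ^ a) (p ^ b)) = card (lattices (p ^ Suc a) (p ^ Suc b))"
proof -
  let ?L = "lattices (p ^ Suc a) (p ^ Suc b)" and ?g = "generated_mod (p ^ Suc a) (p ^ Suc b)"
  have "p > 0" using assms prime_gt_0_nat by blast
  then have fin: "finite ?L" by (intro finite_lattices) auto
  have "lattices (p ^ a) (p ^ b) \<subseteq> ?L"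
  proof
    fix K assume K: "K \<in> lattices (p ^ a) (p ^ b)"
    then have "(int (p ^ a), 0) \<in> K" "(0, int (p ^ b)) \<in> K" by (auto simp: lattices_def)
    then have "(int (p ^ Suc a), 0) \<in> K \<and> (0, int (p ^ Suc b)) \<in> K"
      using lattice_scale[OF K, of _ _ "int p"] by fastforce
    with K show "K \<in> ?L" by (auto simp: lattices_def)
  qed
  then have "lattices (p ^ a) (p ^ b) = {K \<in> ?L. \<not> ?g K}"
  proof (intro equalityI subsetI CollectI conjI)
    fix K assume "K \<in> lattices (p ^ a) (p ^ b)"
    then show "\<not> ?g K"
      using generated_mod_imp_not_torsion[OF assms, of a b K] unfolding lattices_def by blast
  next
    fix K assume "K \<in> {K \<in> ?L. \<not> ?g K}"
    then show "K \<in> lattices (p ^ a) (p ^ b)"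
      using generated_mod_if_not_torsion[OF assms, of K a b] unfolding lattices_def by blast
  qed blast
  moreover have "?L = {K \<in> ?L. ?g K} \<union> {K \<in> ?L. \<not> ?g K}" by auto
  ultimately show ?thesis
    using card_Un_disjoint[of "{K \<in> ?L. ?g K}" "{K \<in> ?L. \<not> ?g K}"] fin by fastforce
qed

section \<open>From subgroups of the product to lattices\<close>

abbreviation (input) mod_prod :: "nat \<Rightarrow> nat \<Rightarrow> (int \<times> int) monoid" where
  "mod_prod m n \<equiv> integer_mod_group m \<times>\<times> integer_mod_group n"

text \<open>The full preimage of \<open>H\<close> under the reduction map from Z x Z.\<close>

definition lattice_of :: "nat \<Rightarrow> nat \<Rightarrow> (int \<times> int) set \<Rightarrow> (int \<times> int) set" where
  "lattice_of m n H = {(x, y). (x mod int m, y mod int n) \<in> H}"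

lemma mem_lattice_of: "(x, y) \<in> lattice_of m n H \<longleftrightarrow> (x mod int m, y mod int n) \<in> H"
  by (simp add: lattice_of_def)

lemma carrier_mod_prod:
  "m > 0 \<Longrightarrow> n > 0 \<Longrightarrow> carrier (mod_prod m n) = {0..<int m} \<times> {0..<int n}"
  by (simp add: carrier_integer_mod_group)

lemma lattice_of_in_lattices:
  assumes mn: "m > 0" "n > 0" and H: "subgroup H (mod_prod m n)"
  shows "lattice_of m n H \<in> lattices m n"
proof -
  have one: "(0, 0) \<in> H" using subgroup.one_closed[OF H] by simp
  have "((x - u) mod int m, (y - w) mod int n) \<in> H"
    if "(x mod int m, y mod int n) \<in> H" "(u mod int m, w mod int n) \<in> H" for x y u w
  proof -
    have "inv\<^bsub>mod_prod m n\<^esub> (u mod int m, w mod int n) = (- u mod int m, - w mod int n)"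
      using mn by (subst inv_DirProd) (auto simp: carrier_integer_mod_group mod_minus_eq)
    with subgroup.m_inv_closed[OF H that(2)]
    have "(- u mod int m, - w mod int n) \<in> H" by simp
    from subgroup.m_closed[OF H that(1) this] show ?thesis by (simp add: mod_simps)
  qed
  with one show ?thesis by (auto simp: lattices_def mem_lattice_of)
qed

lemma lattice_inter_subgroup:
  assumes mn: "m > 0" "n > 0" and K: "K \<in> lattices m n"
  shows "subgroup (K \<inter> carrier (mod_prod m n)) (mod_prod m n)"
proof -
  have red: "(x mod int m, y mod int n) \<in> K" if "(x, y) \<in> K" for x y
    using lattice_cong_mem[OF K that, of "x mod int m" "y mod int n"]
    by (simp add: mod_eq_dvd_iff[symmetric])
  interpret group "mod_prod m n" by (simp add: DirProd_group)
  show ?thesis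
  proof (rule subgroupI)
    show "K \<inter> carrier (mod_prod m n) \<noteq> {}" using lattice_zero[OF K] by auto
    fix v w assume v: "v \<in> K \<inter> carrier (mod_prod m n)"
    obtain x y where xy: "v = (x, y)" by fastforce
    have xm: "x \<in> carrier (integer_mod_group m)" "y \<in> carrier (integer_mod_group n)"
      using v xy by auto
    then have "inv\<^bsub>mod_prod m n\<^esub> v = (- x mod int m, - y mod int n)"
      by (simp add: xy)
    moreover have "(- x mod int m, - y mod int n) \<in> K"
      using red[of "-x" "-y"] lattice_diff[OF K lattice_zero[OF K], of x y] v xy by simp
    ultimately show "inv\<^bsub>mod_prod m n\<^esub> v \<in> K \<inter> carrier (mod_prod m n)"
      using mn by (simp add: carrier_integer_mod_group)
    assume w: "w \<in> K \<inter> carrier (mod_prod m n)"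
    obtain x' y' where xy': "w = (x', y')" by fastforce
    have "v \<otimes>\<^bsub>mod_prod m n\<^esub> w = ((x + x') mod int m, (y + y') mod int n)"
      by (simp add: xy xy')
    moreover have "\<dots> \<in> K"
      using v w xy xy' by (intro red lattice_add[OF K]) auto
    ultimately show "v \<otimes>\<^bsub>mod_prod m n\<^esub> w \<in> K \<inter> carrier (mod_prod m n)"
      using mn by (simp add: carrier_integer_mod_group)
  qed auto
qed

text \<open>The correspondence theorem: the carrier consists of reduced residue pairs, so
  intersecting with it inverts the preimage.\<close>

lemma bij_betw_lattice_of:
  assumes mn: "m > 0" "n > 0"
  shows "bij_betw (lattice_of m n) (subgroups (mod_prod m n)) (lattices m n)"
proof (rule bij_betw_byWitness[where f' = "\<lambda>K. K \<inter> carrier (mod_prod m n)"])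
  show "\<forall>H\<in>subgroups (mod_prod m n). lattice_of m n H \<inter> carrier (mod_prod m n) = H"
  proof
    fix H assume "H \<in> subgroups (mod_prod m n)"
    then have "H \<subseteq> carrier (mod_prod m n)" unfolding subgroups_def mem_Collect_eq by (rule subgroup.subset)
    then show "lattice_of m n H \<inter> carrier (mod_prod m n) = H"
      using mn by (auto simp: carrier_mod_prod mem_lattice_of simp del: carrier_DirProd)
  qed
  show "\<forall>K\<in>lattices m n. lattice_of m n (K \<inter> carrier (mod_prod m n)) = K"
  proof
    fix K assume K: "K \<in> lattices m n"
    have "(x mod int m, y mod int n) \<in> K \<longleftrightarrow> (x, y) \<in> K" for x y
      using lattice_cong_mem[OF K, of x y "x mod int m" "y mod int n"]
        lattice_cong_mem[OF K, of "x mod int m" "y mod int n" x y]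
      by (auto simp: mod_eq_dvd_iff[symmetric])
    then show "lattice_of m n (K \<inter> carrier (mod_prod m n)) = K"
      using mn by (auto simp: carrier_mod_prod mem_lattice_of simp del: carrier_DirProd)
  qed
qed (use lattice_of_in_lattices[OF mn] lattice_inter_subgroup[OF mn] in \<open>auto simp: subgroups_def\<close>)

lemma int_pow_DirProd:
  fixes k :: int
  assumes "group G" "group H" "x \<in> carrier G" "y \<in> carrier H"
  shows "(x, y) [^]\<^bsub>G \<times>\<times> H\<^esub> k = (x [^]\<^bsub>G\<^esub> k, y [^]\<^bsub>H\<^esub> k)"
proof -
  interpret G: group G by fact
  interpret H: group H by fact
  have nat: "(x, y) [^]\<^bsub>G \<times>\<times> H\<^esub> i = (x [^]\<^bsub>G\<^esub> i, y [^]\<^bsub>H\<^esub> i)" for i :: nat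
    by (induction i) auto
  show ?thesis
    using inv_DirProd[OF assms(1,2) G.nat_pow_closed[OF assms(3)] H.nat_pow_closed[OF assms(4)]]
    by (cases "k < 0") (simp_all only: int_pow_def2 nat if_True if_False)
qed

text \<open>Powers in \<open>H\<close> are integer multiples reduced in each coordinate, so equality
  in \<open>H\<close> becomes congruence modulo \<open>m\<close> and \<open>n\<close> in the
  preimage, with the same multiplier \<open>k\<close>.\<close>

lemma cyclic_iff_generated_mod:
  assumes mn: "m > 0" "n > 0" and H: "subgroup H (mod_prod m n)"
  shows "cyclic_group ((mod_prod m n)\<lparr>carrier := H\<rparr>) \<longleftrightarrow> generated_mod m n (lattice_of m n H)"
    (is "?cyc \<longleftrightarrow> ?gen")
proof -
  let ?G = "mod_prod m n"
  let ?r = "\<lambda>x y k. (k * x mod int m, k * y mod int n)"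
  interpret G: group ?G by (simp add: DirProd_group)
  interpret H: group "?G\<lparr>carrier := H\<rparr>" by (rule G.subgroup_imp_group[OF H])
  have sub: "H \<subseteq> {0..<int m} \<times> {0..<int n}"
    using subgroup.subset[OF H] mn by (simp add: carrier_integer_mod_group)
  have pow: "(x, y) [^]\<^bsub>?G\<lparr>carrier := H\<rparr>\<^esub> k = ?r x y k" if "(x, y) \<in> H" for x y and k :: int
  proof -
    have "x \<in> carrier (integer_mod_group m)" "y \<in> carrier (integer_mod_group n)"
      using that sub mn by (auto simp: carrier_integer_mod_group)
    then show ?thesis
      using G.int_pow_consistent[OF H that, of k]
      by (simp add: int_pow_DirProd int_pow_integer_mod_group)
  qed
  have memH: "?r x y k \<in> H" if "(x, y) \<in> H" for x y k
    using H.int_pow_closed[of "(x, y)" k] pow[OF that] that by simp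
  have "?cyc \<longleftrightarrow> (\<exists>(x, y) \<in> H. H = range (?r x y))"
  proof -
    have "range (\<lambda>k::int. v [^]\<^bsub>?G\<lparr>carrier := H\<rparr>\<^esub> k) = range (?r (fst v) (snd v))" if "v \<in> H" for v
      using pow[of "fst v" "snd v"] that by simp
    then show ?thesis unfolding H.cyclic_group by (simp add: case_prod_unfold)
  qed
  \<comment> \<open>All multiples of a member stay in \<open>H\<close>, so only the inclusion of
    \<open>H\<close> in the range is a condition.\<close>
  also have "\<dots> \<longleftrightarrow> (\<exists>(x, y) \<in> H. \<forall>(u, w) \<in> H. \<exists>k. (u, w) = ?r x y k)"
    using memH by fast
  also have "\<dots> \<longleftrightarrow> ?gen"
  proof
    assume "\<exists>(x, y) \<in> H. \<forall>(u, w) \<in> H. \<exists>k. (u, w) = ?r x y k"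
    then obtain x y where xy: "(x, y) \<in> H" and g: "\<And>u w. (u, w) \<in> H \<Longrightarrow> \<exists>k. (u, w) = ?r x y k"
      by blast
    have xyL: "(x, y) \<in> lattice_of m n H" using xy sub by (auto simp: mem_lattice_of)
    show ?gen
      unfolding generated_mod_def
    proof (intro bexI[OF _ xyL], clarify)
      fix u w assume "(u, w) \<in> lattice_of m n H"
      then obtain k where "(u mod int m, w mod int n) = ?r x y k"
        using g by (auto simp: mem_lattice_of)
      then show "\<exists>k. int m dvd u - k * x \<and> int n dvd w - k * y"
        by (auto simp: mod_eq_dvd_iff)
    qed
  next
    assume ?gen
    then obtain x y where xy: "(x mod int m, y mod int n) \<in> H"
      and g: "\<And>u w. (u mod int m, w mod int n) \<in> H \<Longrightarrow> \<exists>k. int m dvd u - k * x \<and> int n dvd w - k * y"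
      by (fastforce simp: generated_mod_def mem_lattice_of)
    show "\<exists>(x, y) \<in> H. \<forall>(u, w) \<in> H. \<exists>k. (u, w) = ?r x y k"
    \<comment> \<open>A generator found in the preimage need not be reduced; its residues generate
      \<open>H\<close>.\<close>
    proof (intro bexI[OF _ xy], clarify)
      fix u w assume uw: "(u, w) \<in> H"
      then have [simp]: "u mod int m = u" "w mod int n = w" using sub by auto
      obtain k where "u mod int m = (k * x) mod int m" "w mod int n = (k * y) mod int n"
        using g[of u w] uw unfolding mod_eq_dvd_iff by auto
      then show "\<exists>k. (u, w) = ?r (x mod int m) (y mod int n) k"
        by (auto simp: mod_mult_right_eq)
    qed
  qed
  finally show ?thesis .
qed

lemma cdeg_mod_prod:
  assumes "m > 0" "n > 0"
  shows "cdeg (mod_prod m n) =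
    real (card {K \<in> lattices m n. generated_mod m n K}) / real (card (lattices m n))"
proof -
  note bij = bij_betw_lattice_of[OF assms]
  have "cyclic_subgroups (mod_prod m n) =
      {H \<in> subgroups (mod_prod m n). generated_mod m n (lattice_of m n H)}"
    using cyclic_iff_generated_mod[OF assms] by (auto simp: cyclic_subgroups_def subgroups_def)
  moreover have "bij_betw (lattice_of m n)
      {H \<in> subgroups (mod_prod m n). generated_mod m n (lattice_of m n H)}
      {K \<in> lattices m n. generated_mod m n K}"
    unfolding bij_betw_def
  proof
    show "inj_on (lattice_of m n) {H \<in> subgroups (mod_prod m n). generated_mod m n (lattice_of m n H)}"
      using bij by (auto simp: bij_betw_def intro: inj_on_subset)
    show "lattice_of m n ` {H \<in> subgroups (mod_prod m n). generated_mod m n (lattice_of m n H)} =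
        {K \<in> lattices m n. generated_mod m n K}"
      unfolding bij_betw_imp_surj_on[OF bij, symmetric] by blast
  qed
  ultimately show ?thesis
    using bij_betw_same_card[OF bij] by (simp add: cdeg_def bij_betw_same_card)
qed

section \<open>The cyclicity degree\<close>

theorem corollary3p1p2:
  fixes p \<alpha>\<^sub>1 \<alpha>\<^sub>2 :: nat
  assumes "prime p" and "1 \<le> \<alpha>\<^sub>1" and "\<alpha>\<^sub>1 \<le> \<alpha>\<^sub>2"
  shows "cdeg (integer_mod_group (p ^ \<alpha>\<^sub>1) \<times>\<times> integer_mod_group (p ^ \<alpha>\<^sub>2)) =
    ((real \<alpha>\<^sub>2 - real \<alpha>\<^sub>1 + 1) * real p ^ (\<alpha>\<^sub>1 + 2)
       - 2 * (real \<alpha>\<^sub>2 - real \<alpha>\<^sub>1) * real p ^ (\<alpha>\<^sub>1 + 1)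
       + (real \<alpha>\<^sub>2 - real \<alpha>\<^sub>1 - 1) * real p ^ \<alpha>\<^sub>1
       - 2 * real p + 2) /
    ((real \<alpha>\<^sub>2 - real \<alpha>\<^sub>1 + 1) * real p ^ (\<alpha>\<^sub>1 + 2)
       - (real \<alpha>\<^sub>2 - real \<alpha>\<^sub>1 - 1) * real p ^ (\<alpha>\<^sub>1 + 1)
       - (real \<alpha>\<^sub>1 + real \<alpha>\<^sub>2 + 3) * real p
       + (real \<alpha>\<^sub>1 + real \<alpha>\<^sub>2 + 1))" (is "_ = ?num / ?den")
proof -
  \<comment> \<open>Because \<open>1 \<le> \<alpha>\<^sub>1\<close>, this subtraction is exact.
    Lowering both exponents by one keeps their difference \<open>c\<close>, so both lattice counts
    are values of the same \<open>L\<close>.\<close>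
  define a where "a = \<alpha>\<^sub>1 - 1"
  define c where "c = \<alpha>\<^sub>2 - \<alpha>\<^sub>1"
  have \<alpha>: "\<alpha>\<^sub>1 = Suc a" "\<alpha>\<^sub>2 = Suc (a + c)" using assms by (auto simp: a_def c_def)
  define L where "L = (\<lambda>i. real (card (lattices (p ^ i) (p ^ (i + c)))))"
  define C where "C = real (card {K \<in> lattices (p ^ \<alpha>\<^sub>1) (p ^ \<alpha>\<^sub>2). generated_mod (p ^ \<alpha>\<^sub>1) (p ^ \<alpha>\<^sub>2) K})"
  have p: "real p > 1" using assms(1) prime_gt_1_nat by force
  have L: "(real p - 1)\<^sup>2 * L i = (real c + 1) * real p ^ (i + 2) - (real c - 1) * real p ^ (i + 1)
      - (2 * real i + real c + 3) * real p + (2 * real i + real c + 1)" for i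
    unfolding L_def card_lattices_prime_power[OF assms(1)] sum_power_min_closed_form[symmetric]
    by simp
  have "C + L a = L (Suc a)"
    using card_generated_lattices[OF assms(1), of a "a + c"]
    unfolding C_def L_def \<alpha> by (simp only: of_nat_add[symmetric] add_Suc)
  then have "C = L (Suc a) - L a" by simp
  then have "(real p - 1)\<^sup>2 * C = (real p - 1)\<^sup>2 * L (Suc a) - (real p - 1)\<^sup>2 * L a"
    by (simp only: right_diff_distrib)
  then have num: "(real p - 1)\<^sup>2 * C = ?num"
    unfolding L by (simp add: \<alpha> algebra_simps)
  have den: "(real p - 1)\<^sup>2 * L (Suc a) = ?den"
    unfolding L by (simp add: \<alpha> algebra_simps)
  have "cdeg (mod_prod (p ^ \<alpha>\<^sub>1) (p ^ \<alpha>\<^sub>2)) = C / L (Suc a)"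
    using cdeg_mod_prod[of "p ^ \<alpha>\<^sub>1" "p ^ \<alpha>\<^sub>2"] p by (simp add: C_def L_def \<alpha>)
  \<comment> \<open>The fraction is expanded by \<open>(real p - 1)\<^sup>2\<close>, nonzero as
    \<open>p > 1\<close>, to reach the closed forms.\<close>
  also have "\<dots> = ((real p - 1)\<^sup>2 * C) / ((real p - 1)\<^sup>2 * L (Suc a))"
    using p by simp
  finally show ?thesis unfolding num den .
qed

end
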